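(* Let $m\ge0$ and $\theta\in(-\frac{\pi}{2},\frac{\pi}{2})$ with $\theta\neq0$. Then $H_\theta$ is not quasi-self-adjoint, i.e. it is not similar, via a bounded and boundedly invertible transformation of $L^2(\mathbb{R})^4$, to a self-adjoint operator.
   Context: Pauli matrices: $\sigma_1=\begin{pmatrix}0&1\\1&0\end{pmatrix}$, $\sigma_2=\begin{pmatrix}0&-i\\i&0\end{pmatrix}$, $\sigma_3=\begin{pmatrix}1&0\\0&-1\end{pmatrix}$; Dirac matrices $\alpha_k=\begin{pmatrix}0&\sigma_k\\\sigma_k&0\end{pmatrix}$, $k=1,2,3$. For $m\ge0$ and $|\theta|<\frac{\pi}{2}$, the operator $H_\theta$ acts in $L^2(\mathbb{R})^4=L^2(\mathbb{R};\mathbb{C}^4)$ by $$H_\theta=-i\alpha_1e^{-i\theta/2}\partial_x-\alpha_2e^{i\theta/2}x+m\alpha_3,\qquad \mathsf{D}(H_\theta)=\mathcal{D}^4,\quad \mathcal{D}=H^1(\mathbb{R})\cap L^2(\mathbb{R},x^2\,dx).$$ *)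

theory Defs
  imports "HOL-Analysis.Analysis"
begin

definition square_integrable :: "(real \<Rightarrow> 'a::euclidean_space) \<Rightarrow> bool" where
  "square_integrable f \<longleftrightarrow>
     f \<in> borel_measurable lborel \<and> integrable lborel (\<lambda>x. (norm (f x))\<^sup>2)"

lemma square_integrable_zero: "square_integrable (\<lambda>x. 0)"
  by (simp add: square_integrable_def)

lemma square_integrable_add:
  assumes "square_integrable f" "square_integrable g"
  shows "square_integrable (\<lambda>x. f x + g x)"
proof -
  have [measurable]: "f \<in> borel_measurable lborel" "g \<in> borel_measurable lborel"
    using assms by (auto simp: square_integrable_def)
  have "integrable lborel (\<lambda>x. (norm (f x + g x))\<^sup>2)"
  proof (rule Bochner_Integration.integrable_bound)
    show "integrable lborel (\<lambda>x. 2 * (norm (f x))\<^sup>2 + 2 * (norm (g x))\<^sup>2)"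
      using assms by (auto simp: square_integrable_def)
    have "(norm (f x + g x))\<^sup>2 \<le> 2 * (norm (f x))\<^sup>2 + 2 * (norm (g x))\<^sup>2" for x
    proof -
      have "(norm (f x + g x))\<^sup>2 \<le> (norm (f x) + norm (g x))\<^sup>2"
        by (intro power_mono norm_triangle_ineq) auto
      also have "\<dots> \<le> 2 * (norm (f x))\<^sup>2 + 2 * (norm (g x))\<^sup>2"
        using sum_squares_bound[of "norm (f x)" "norm (g x)"] by (simp add: power2_sum)
      finally show ?thesis .
    qed
    then show "AE x in lborel. norm ((norm (f x + g x))\<^sup>2)
        \<le> norm (2 * (norm (f x))\<^sup>2 + 2 * (norm (g x))\<^sup>2)"
      by auto
  qed measurable
  then show ?thesis by (simp add: square_integrable_def)
qed

lemma square_integrable_bound: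
  fixes f :: "real \<Rightarrow> 'a::euclidean_space" and g :: "real \<Rightarrow> 'b::euclidean_space"
  assumes "square_integrable f" "g \<in> borel_measurable lborel"
    and "\<And>x. norm (g x) \<le> C * norm (f x)"
  shows "square_integrable g"
proof -
  have [measurable]: "f \<in> borel_measurable lborel" "g \<in> borel_measurable lborel"
    using assms by (auto simp: square_integrable_def)
  have "integrable lborel (\<lambda>x. (norm (g x))\<^sup>2)"
  proof (rule Bochner_Integration.integrable_bound)
    show "integrable lborel (\<lambda>x. C\<^sup>2 * (norm (f x))\<^sup>2)"
      using assms by (auto simp: square_integrable_def)
    have "(norm (g x))\<^sup>2 \<le> C\<^sup>2 * (norm (f x))\<^sup>2" for x
      using power_mono[OF assms(3)[of x] norm_ge_zero, of 2] by (simp add: power_mult_distrib)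
    then show "AE x in lborel. norm ((norm (g x))\<^sup>2) \<le> norm (C\<^sup>2 * (norm (f x))\<^sup>2)"
      by auto
  qed measurable
  then show ?thesis by (simp add: square_integrable_def)
qed

lemma square_integrable_linear:
  fixes h :: "'a::euclidean_space \<Rightarrow> 'b::euclidean_space"
  assumes "linear h" "square_integrable f"
  shows "square_integrable (\<lambda>x. h (f x))"
proof -
  have bl: "bounded_linear h" using assms(1) by (rule linear_conv_bounded_linear[THEN iffD1])
  then obtain K where "\<And>x. norm (h x) \<le> norm x * K"
    using bounded_linear.bounded by blast
  moreover have "(\<lambda>x. h (f x)) \<in> borel_measurable lborel"
  proof -
    have "h \<in> borel_measurable borel"
      using bl by (intro borel_measurable_continuous_onI linear_continuous_on)
    then show ?thesis
      using assms(2) by (intro measurable_compose[of f lborel borel h]) (auto simp: square_integrable_def)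
  qed
  ultimately show ?thesis
    using square_integrable_bound[OF assms(2), of "\<lambda>x. h (f x)" K] by (simp add: mult.commute)
qed

lemma square_integrable_scaleR:
  "square_integrable f \<Longrightarrow> square_integrable (\<lambda>x. c *\<^sub>R f x)"
  by (rule square_integrable_linear) (auto intro!: linearI simp: algebra_simps)

lemma linear_vector_scalar_mult: "linear (\<lambda>v::complex^'n. c *s v)"
  by (rule linearI) (auto simp: vec_eq_iff algebra_simps)

lemma linear_matrix_vector_mult: "linear (\<lambda>v. (A :: complex^'n^'m) *v v)"
  by (rule linearI)
     (simp_all add: matrix_vector_mult_def vec_eq_iff scaleR_sum_right distrib_left sum.distrib)

lemma square_integrable_smult:
  fixes f :: "real \<Rightarrow> complex^'n"
  shows "square_integrable f \<Longrightarrow> square_integrable (\<lambda>x. c *s f x)"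
  by (rule square_integrable_linear[OF linear_vector_scalar_mult])

lemma square_integrable_matrix:
  fixes f :: "real \<Rightarrow> complex^'n"
  shows "square_integrable f \<Longrightarrow> square_integrable (\<lambda>x. (A :: complex^'n^'m) *v f x)"
  by (rule square_integrable_linear[OF linear_matrix_vector_mult])

lemma square_integrable_vec_iff:
  fixes f :: "real \<Rightarrow> complex^'n"
  shows "square_integrable f \<longleftrightarrow> (\<forall>k. square_integrable (\<lambda>x. f x $ k))"
proof
  assume "square_integrable f"
  then show "\<forall>k. square_integrable (\<lambda>x. f x $ k)"
    using square_integrable_linear[of "\<lambda>v::complex^'n. v $ k" f for k]
    by (simp add: bounded_linear.linear bounded_linear_vec_nth)
next
  assume A: "\<forall>k. square_integrable (\<lambda>x. f x $ k)"
  have ax: "square_integrable (\<lambda>x. axis k (f x $ k))" for k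
  proof (rule square_integrable_linear[where h = "axis k"])
    show "linear (axis k :: complex \<Rightarrow> complex^'n)"
      by (rule linearI) (auto simp: axis_def vec_eq_iff)
  qed (use A in blast)
  have "square_integrable (\<lambda>x. \<Sum>k\<in>K. axis k (f x $ k))" if "finite K" for K :: "'n set"
    using that
  proof (induction K rule: finite_induct)
    case empty
    show ?case by (simp add: square_integrable_zero)
  next
    case (insert k K)
    then show ?case by (simp add: square_integrable_add ax)
  qed
  moreover have "(\<Sum>k\<in>UNIV. axis k (f x $ k)) = f x" for x
    by (simp add: vec_eq_iff axis_def)
  ultimately show "square_integrable f"
    using finite[of "UNIV :: 'n set"] by fastforce
qed

lemma square_integrable_mult:
  fixes f :: "real \<Rightarrow> 'a::euclidean_space" and g :: "real \<Rightarrow> 'b::euclidean_space"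
    and h :: "real \<Rightarrow> 'c::euclidean_space"
  assumes "square_integrable f" "square_integrable g" "h \<in> borel_measurable lborel"
    and "\<And>x. norm (h x) \<le> norm (f x) * norm (g x)"
  shows "integrable lborel h"
proof (rule Bochner_Integration.integrable_bound)
  show "integrable lborel (\<lambda>x. (norm (f x))\<^sup>2 + (norm (g x))\<^sup>2)"
    using assms by (auto simp: square_integrable_def)
  have "norm (h x) \<le> (norm (f x))\<^sup>2 + (norm (g x))\<^sup>2" for x
  proof -
    have "2 * (norm (f x) * norm (g x)) \<le> (norm (f x))\<^sup>2 + (norm (g x))\<^sup>2"
      using sum_squares_bound[of "norm (f x)" "norm (g x)"] by simp
    moreover have "0 \<le> norm (f x) * norm (g x)" by simp
    ultimately show ?thesis using assms(4)[of x] by linarith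
  qed
  then show "AE x in lborel. norm (h x) \<le> norm ((norm (f x))\<^sup>2 + (norm (g x))\<^sup>2)"
    by auto
qed (use assms in auto)

lemma square_integrable_inner:
  assumes "square_integrable f" "square_integrable g"
  shows "integrable lborel (\<lambda>x. f x \<bullet> g x)"
proof (rule square_integrable_mult[OF assms])
  have [measurable]: "f \<in> borel_measurable lborel" "g \<in> borel_measurable lborel"
    using assms by (auto simp: square_integrable_def)
  show "(\<lambda>x. f x \<bullet> g x) \<in> borel_measurable lborel" by measurable
qed (simp add: Cauchy_Schwarz_ineq2)

quotient_type spinor_L2 = "real \<Rightarrow> complex^4" / partial:
  "\<lambda>f g. square_integrable f \<and> square_integrable g \<and> (AE x in lborel. f x = g x)"
  morphisms rep_L2 L2_class
proof (rule part_equivpI)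
  show "\<exists>f :: real \<Rightarrow> complex^4.
      square_integrable f \<and> square_integrable f \<and> (AE x in lborel. f x = f x)"
    by (rule exI[of _ "\<lambda>_. 0"]) (simp add: square_integrable_zero)
  show "symp (\<lambda>f g :: real \<Rightarrow> complex^4.
      square_integrable f \<and> square_integrable g \<and> (AE x in lborel. f x = g x))"
    by (auto simp: symp_def elim: eventually_mono)
  show "transp (\<lambda>f g :: real \<Rightarrow> complex^4.
      square_integrable f \<and> square_integrable g \<and> (AE x in lborel. f x = g x))"
  proof (rule transpI, elim conjE, intro conjI)
    fix f g h :: "real \<Rightarrow> complex^4"
    assume "AE x in lborel. f x = g x" "AE x in lborel. g x = h x"
    then show "AE x in lborel. f x = h x" by eventually_elim simp
  qed
qed

instantiation spinor_L2 :: real_inner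
begin

lift_definition zero_spinor_L2 :: spinor_L2 is "\<lambda>_. 0"
  by (simp add: square_integrable_zero)

lift_definition plus_spinor_L2 :: "spinor_L2 \<Rightarrow> spinor_L2 \<Rightarrow> spinor_L2" is "\<lambda>f g x. f x + g x"
  by (auto intro: square_integrable_add elim!: eventually_elim2)

lift_definition uminus_spinor_L2 :: "spinor_L2 \<Rightarrow> spinor_L2" is "\<lambda>f x. - f x"
  by (auto elim!: eventually_mono dest: square_integrable_scaleR[where c = "-1"])

definition minus_spinor_L2 :: "spinor_L2 \<Rightarrow> spinor_L2 \<Rightarrow> spinor_L2" where
  "minus_spinor_L2 u v = u + - v"

lift_definition scaleR_spinor_L2 :: "real \<Rightarrow> spinor_L2 \<Rightarrow> spinor_L2" is "\<lambda>c f x. c *\<^sub>R f x"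
  by (auto intro: square_integrable_scaleR elim!: eventually_mono)

lift_definition inner_spinor_L2 :: "spinor_L2 \<Rightarrow> spinor_L2 \<Rightarrow> real" is
  "\<lambda>f g. LINT x|lborel. f x \<bullet> g x"
proof (elim conjE)
  fix f f' g g' :: "real \<Rightarrow> complex^4"
  assume sq: "square_integrable f" "square_integrable f'" "square_integrable g" "square_integrable g'"
  assume "AE x in lborel. f x = f' x" "AE x in lborel. g x = g' x"
  then have "AE x in lborel. f x \<bullet> g x = f' x \<bullet> g' x" by eventually_elim simp
  then show "(LINT x|lborel. f x \<bullet> g x) = (LINT x|lborel. f' x \<bullet> g' x)"
    using sq[THEN square_integrable_inner] sq
    by (intro integral_cong_AE borel_measurable_integrable square_integrable_inner) auto
qed

definition norm_spinor_L2 :: "spinor_L2 \<Rightarrow> real" where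
  "norm_spinor_L2 u = sqrt (u \<bullet> u)"

definition sgn_spinor_L2 :: "spinor_L2 \<Rightarrow> spinor_L2" where
  "sgn_spinor_L2 u = inverse (norm u) *\<^sub>R u"

definition dist_spinor_L2 :: "spinor_L2 \<Rightarrow> spinor_L2 \<Rightarrow> real" where
  "dist_spinor_L2 u v = norm (u - v)"

definition uniformity_spinor_L2 :: "(spinor_L2 \<times> spinor_L2) filter" where
  "uniformity_spinor_L2 = (INF e\<in>{0<..}. principal {(u, v). dist u v < e})"

definition open_spinor_L2 :: "spinor_L2 set \<Rightarrow> bool" where
  "open_spinor_L2 U \<longleftrightarrow> (\<forall>u\<in>U. \<forall>\<^sub>F (u', v) in uniformity. u' = u \<longrightarrow> v \<in> U)"

instance
proof
  fix u v w :: spinor_L2 and a b r :: real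
  show "u + v + w = u + (v + w)"
    by transfer (auto simp: add.assoc intro!: square_integrable_add)
  show "u + v = v + u"
    by transfer (auto simp: add.commute intro!: square_integrable_add)
  show "0 + u = u" by transfer auto
  show "- u + u = 0"
    by transfer (auto simp: square_integrable_zero)
  show "u - v = u + - v" by (rule minus_spinor_L2_def)
  show "a *\<^sub>R (u + v) = a *\<^sub>R u + a *\<^sub>R v"
    by transfer (auto simp: scaleR_add_right intro!: square_integrable_add square_integrable_scaleR)
  show "(a + b) *\<^sub>R u = a *\<^sub>R u + b *\<^sub>R u"
    by transfer (auto simp: scaleR_add_left intro!: square_integrable_add square_integrable_scaleR)
  show "a *\<^sub>R b *\<^sub>R u = (a * b) *\<^sub>R u"
    by transfer (auto intro!: square_integrable_scaleR)
  show "1 *\<^sub>R u = u" by transfer auto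
  show "dist u v = norm (u - v)" by (rule dist_spinor_L2_def)
  show "sgn u = inverse (norm u) *\<^sub>R u" by (rule sgn_spinor_L2_def)
  show "(uniformity :: (spinor_L2 \<times> spinor_L2) filter)
      = (INF e\<in>{0<..}. principal {(u, v). dist u v < e})"
    by (rule uniformity_spinor_L2_def)
  show "open U \<longleftrightarrow> (\<forall>u\<in>U. \<forall>\<^sub>F (u', v) in uniformity. u' = u \<longrightarrow> v \<in> U)"
    for U :: "spinor_L2 set"
    by (rule open_spinor_L2_def)
  show "u \<bullet> v = v \<bullet> u" by transfer (simp add: inner_commute)
  show "(u + v) \<bullet> w = u \<bullet> w + v \<bullet> w"
    by transfer (simp add: inner_add_left Bochner_Integration.integral_add square_integrable_inner)
  show "(r *\<^sub>R u) \<bullet> v = r * (u \<bullet> v)" by transfer simp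
  show "0 \<le> u \<bullet> u" by transfer simp
  show "u \<bullet> u = 0 \<longleftrightarrow> u = 0"
  proof transfer
    fix f :: "real \<Rightarrow> complex^4"
    assume f: "square_integrable f \<and> square_integrable f \<and> (AE x in lborel. f x = f x)"
    have "(LINT x|lborel. f x \<bullet> f x) = 0 \<longleftrightarrow> (AE x in lborel. f x \<bullet> f x = 0)"
      using f by (intro integral_nonneg_eq_0_iff_AE square_integrable_inner) auto
    then show "(LINT x|lborel. f x \<bullet> f x) = 0 \<longleftrightarrow>
        square_integrable f \<and> square_integrable (\<lambda>_. 0 :: complex^4) \<and> (AE x in lborel. f x = 0)"
      using f by (simp add: square_integrable_zero)
  qed
  show "norm u = sqrt (u \<bullet> u)" by (rule norm_spinor_L2_def)
qed

end

lift_definition cscale :: "complex \<Rightarrow> spinor_L2 \<Rightarrow> spinor_L2" is "\<lambda>c f x. c *s f x"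
  by (auto intro: square_integrable_smult elim!: eventually_mono)

lemma square_integrable_cinner:
  fixes f g :: "real \<Rightarrow> complex^'n"
  assumes "square_integrable f" "square_integrable g"
  shows "integrable lborel (\<lambda>x. \<Sum>k\<in>UNIV. cnj (f x $ k) * g x $ k)"
proof (rule Bochner_Integration.integrable_sum)
  fix k
  have sq: "square_integrable (\<lambda>x. f x $ k)" "square_integrable (\<lambda>x. g x $ k)"
    using assms square_integrable_vec_iff by blast+
  then have "(\<lambda>x. f x $ k) \<in> borel_measurable lborel" "(\<lambda>x. g x $ k) \<in> borel_measurable lborel"
    by (auto simp: square_integrable_def)
  moreover have "cnj \<in> borel_measurable borel"
    by (intro borel_measurable_continuous_onI continuous_intros)
  ultimately have "(\<lambda>x. cnj (f x $ k) * g x $ k) \<in> borel_measurable lborel"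
    by (intro borel_measurable_times measurable_compose[of _ lborel borel cnj]) auto
  then show "integrable lborel (\<lambda>x. cnj (f x $ k) * g x $ k)"
    by (rule square_integrable_mult[OF sq]) (simp add: norm_mult)
qed

lift_definition cinner :: "spinor_L2 \<Rightarrow> spinor_L2 \<Rightarrow> complex" is
  "\<lambda>f g. LINT x|lborel. (\<Sum>k\<in>UNIV. cnj (f x $ k) * g x $ k)"
proof (elim conjE)
  fix f f' g g' :: "real \<Rightarrow> complex^4"
  assume sq: "square_integrable f" "square_integrable f'" "square_integrable g" "square_integrable g'"
  assume "AE x in lborel. f x = f' x" "AE x in lborel. g x = g' x"
  then have "AE x in lborel. (\<Sum>k\<in>UNIV. cnj (f x $ k) * g x $ k)
      = (\<Sum>k\<in>UNIV. cnj (f' x $ k) * g' x $ k)" by eventually_elim simp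
  then show "(LINT x|lborel. (\<Sum>k\<in>UNIV. cnj (f x $ k) * g x $ k))
      = (LINT x|lborel. (\<Sum>k\<in>UNIV. cnj (f' x $ k) * g' x $ k))"
    using sq by (intro integral_cong_AE borel_measurable_integrable square_integrable_cinner) auto
qed

lemma Re_cinner: "Re (cinner u v) = u \<bullet> v"
proof transfer
  fix f g :: "real \<Rightarrow> complex^4"
  assume "square_integrable f \<and> square_integrable f \<and> (AE x in lborel. f x = f x)"
    and "square_integrable g \<and> square_integrable g \<and> (AE x in lborel. g x = g x)"
  then have "Re (LINT x|lborel. (\<Sum>k\<in>UNIV. cnj (f x $ k) * g x $ k))
      = (LINT x|lborel. Re (\<Sum>k\<in>UNIV. cnj (f x $ k) * g x $ k))"
    by (intro integral_Re[symmetric] square_integrable_cinner) auto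
  also have "\<dots> = (LINT x|lborel. f x \<bullet> g x)"
    by (simp add: inner_vec_def inner_complex_def)
  finally show "Re (LINT x|lborel. (\<Sum>k\<in>UNIV. cnj (f x $ k) * g x $ k))
      = (LINT x|lborel. f x \<bullet> g x)" .
qed

lemma scaleR_eq_cscale: "r *\<^sub>R u = cscale (complex_of_real r) u"
proof -
  have "r *\<^sub>R v = complex_of_real r *s v" for v :: "complex^4"
    by (simp add: vec_eq_iff) (simp add: scaleR_conv_of_real)
  then show ?thesis
    by transfer (auto intro!: square_integrable_smult)
qed

definition bounded_clinear :: "(spinor_L2 \<Rightarrow> spinor_L2) \<Rightarrow> bool" where
  "bounded_clinear W \<longleftrightarrow> bounded_linear W \<and> (\<forall>c u. W (cscale c u) = cscale c (W u))"

text \<open>An unbounded operator is represented by its graph, so its domain is \<^term>\<open>Domain T\<close>.\<close>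

type_synonym operator = "(spinor_L2 \<times> spinor_L2) set"

definition adjoint_op :: "operator \<Rightarrow> operator" where
  "adjoint_op T = {(v, w). \<forall>(u, f)\<in>T. cinner v f = cinner w u}"

text \<open>Density of the domain makes \<^term>\<open>adjoint_op A\<close> single-valued; as an adjoint, a graph
  with \<^term>\<open>adjoint_op A = A\<close> is a closed complex subspace.\<close>

definition self_adjoint :: "operator \<Rightarrow> bool" where
  "self_adjoint A \<longleftrightarrow> closure (Domain A) = UNIV \<and> adjoint_op A = A"

text \<open>The graph of \<open>W T W\<^sup>-\<^sup>1\<close>, whose domain is the image of the domain of \<open>T\<close> under \<open>W\<close>.\<close>

definition conjugate_op :: "(spinor_L2 \<Rightarrow> spinor_L2) \<Rightarrow> operator \<Rightarrow> operator" where
  "conjugate_op W T = {(W u, W f) | u f. (u, f) \<in> T}"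

definition quasi_self_adjoint :: "operator \<Rightarrow> bool" where
  "quasi_self_adjoint T \<longleftrightarrow>
     (\<exists>W. bounded_clinear W \<and> bij W \<and> bounded_clinear (inv W) \<and> self_adjoint (conjugate_op W T))"

definition test_function :: "(real \<Rightarrow> real) \<Rightarrow> bool" where
  "test_function \<phi> \<longleftrightarrow>
     (\<forall>n x. (deriv ^^ n) \<phi> differentiable (at x)) \<and> compact (closure {x. \<phi> x \<noteq> 0})"

definition weak_derivative :: "(real \<Rightarrow> complex) \<Rightarrow> (real \<Rightarrow> complex) \<Rightarrow> bool" where
  "weak_derivative u v \<longleftrightarrow>
     (\<forall>\<phi>. test_function \<phi> \<longrightarrow>
        (LINT x|lborel. deriv \<phi> x *\<^sub>R u x) = - (LINT x|lborel. \<phi> x *\<^sub>R v x))"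

definition sobolev_H1 :: "(real \<Rightarrow> complex) set" where
  "sobolev_H1 = {u. square_integrable u \<and> (\<exists>v. square_integrable v \<and> weak_derivative u v)}"

definition weighted_L2 :: "(real \<Rightarrow> complex) set" where
  "weighted_L2 = {u. u \<in> borel_measurable lborel \<and>
     integrable lborel (\<lambda>x. (norm (u x))\<^sup>2 * x\<^sup>2)}"

definition domain_D :: "(real \<Rightarrow> complex) set" where
  "domain_D = sobolev_H1 \<inter> weighted_L2"

definition pauli1 :: "complex^2^2" where
  "pauli1 = vector [vector [0, 1], vector [1, 0]]"

definition pauli2 :: "complex^2^2" where
  "pauli2 = vector [vector [0, - \<i>], vector [\<i>, 0]]"

definition pauli3 :: "complex^2^2" where
  "pauli3 = vector [vector [1, 0], vector [0, - 1]]"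

definition dirac_block :: "complex^2^2 \<Rightarrow> complex^4^4" where
  "dirac_block s = vector
    [vector [0, 0, s$1$1, s$1$2],
     vector [0, 0, s$2$1, s$2$2],
     vector [s$1$1, s$1$2, 0, 0],
     vector [s$2$1, s$2$2, 0, 0]]"

definition alpha1 :: "complex^4^4" where "alpha1 = dirac_block pauli1"
definition alpha2 :: "complex^4^4" where "alpha2 = dirac_block pauli2"
definition alpha3 :: "complex^4^4" where "alpha3 = dirac_block pauli3"

text \<open>\<open>H_expr m \<theta> u v\<close> is the differential expression evaluated on a spinor \<open>u\<close> with
  (weak) derivative \<open>v\<close>.\<close>

definition H_expr ::
  "real \<Rightarrow> real \<Rightarrow> (real \<Rightarrow> complex^4) \<Rightarrow> (real \<Rightarrow> complex^4) \<Rightarrow> real \<Rightarrow> complex^4" where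
  "H_expr m \<theta> u v x =
     (- \<i> * exp (- \<i> * complex_of_real \<theta> / 2)) *s (alpha1 *v v x)
     - (exp (\<i> * complex_of_real \<theta> / 2) * complex_of_real x) *s (alpha2 *v u x)
     + complex_of_real m *s (alpha3 *v u x)"

definition H_op :: "real \<Rightarrow> real \<Rightarrow> operator" where
  "H_op m \<theta> = {(L2_class u, L2_class (H_expr m \<theta> u v)) | u v.
     \<forall>k. (\<lambda>x. u x $ k) \<in> domain_D \<and>
         square_integrable (\<lambda>x. v x $ k) \<and> weak_derivative (\<lambda>x. u x $ k) (\<lambda>x. v x $ k)}"

text \<open>Hence every use of \<^const>\<open>L2_class\<close> in \<^const>\<open>H_op\<close> is on a square-integrable function.\<close>

lemma square_integrable_H:
  assumes "\<And>k. (\<lambda>x. u x $ k) \<in> domain_D" "\<And>k. square_integrable (\<lambda>x. v x $ k)"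
  shows "square_integrable u" "square_integrable (H_expr m \<theta> u v)"
proof -
  show u: "square_integrable u"
    using assms(1) by (subst square_integrable_vec_iff) (auto simp: domain_D_def sobolev_H1_def)
  have v: "square_integrable v"
    using assms(2) by (subst square_integrable_vec_iff) auto
  have "square_integrable (\<lambda>x. (complex_of_real x *s u x) $ k)" for k
  proof -
    have "integrable lborel (\<lambda>x. (norm (u x $ k))\<^sup>2 * x\<^sup>2)"
      and [measurable]: "(\<lambda>x. u x $ k) \<in> borel_measurable lborel"
      using assms(1)[of k] by (auto simp: domain_D_def weighted_L2_def)
    moreover have "(\<lambda>x. complex_of_real x * u x $ k) \<in> borel_measurable lborel"
      by measurable
    ultimately show ?thesis
      by (simp add: square_integrable_def norm_mult power_mult_distrib mult.commute)
  qed
  then have xu: "square_integrable (\<lambda>x. complex_of_real x *s u x)"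
    by (subst square_integrable_vec_iff) blast
  have "H_expr m \<theta> u v = (\<lambda>x.
      (- \<i> * exp (- \<i> * complex_of_real \<theta> / 2)) *s (alpha1 *v v x)
      + ((- exp (\<i> * complex_of_real \<theta> / 2)) *s (alpha2 *v (complex_of_real x *s u x))
      + complex_of_real m *s (alpha3 *v u x)))"
    by (rule ext) (simp add: H_expr_def vec_eq_iff matrix_vector_mult_def sum_distrib_left sum_negf
      algebra_simps)
  then show "square_integrable (H_expr m \<theta> u v)"
    using u v xu
    by (simp only:)
       (intro square_integrable_add square_integrable_smult square_integrable_matrix)
qed

end

(* If W H W^-1 is self-adjoint, then |Im z| |u| <= C |(H - z) u| for all u in the domain, with
   C = |W| |W^-1|.  The matrix -alpha_2 has an eigenvector eta for the eigenvalue 1, so for a Gaussian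
   centred at R, u(x) = gauss(x - R) eta, and z = R exp(i theta / 2), the operator H - z reduces to
   derivatives of the Gaussian, multiplication by x - R and the mass term: (H - z) u is a translate
   of a function independent of R.  But Im z = R sin(theta / 2) is unbounded. *)

theory Submission
  imports Defs "HOL-Probability.Distributions"
begin

section \<open>Weak derivatives of C^1 functions\<close>

text \<open>Integration by parts: \<open>\<phi> u\<close> is C^1 with compact support, so by the
  fundamental theorem of calculus its derivative \<open>\<phi>' u + \<phi> v\<close> integrates to
  zero.\<close>

lemma weak_derivative_C1:
  assumes u: "\<And>x. (u has_vector_derivative v x) (at x)"
    and v: "continuous_on UNIV v"
  shows "weak_derivative u v"
  unfolding weak_derivative_def
proof (intro allI impI)
  fix \<phi> assume \<phi>: "test_function \<phi>"
  let ?d = "\<lambda>x. deriv \<phi> x *\<^sub>R u x" and ?e = "\<lambda>x. \<phi> x *\<^sub>R v x"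
  have "(deriv ^^ 0) \<phi> differentiable (at x)" "(deriv ^^ 1) \<phi> differentiable (at x)" for x
    using \<phi> unfolding test_function_def by blast+
  then have D: "(\<phi> has_real_derivative deriv \<phi> x) (at x)"
    and D2: "deriv \<phi> differentiable (at x)" for x
    by (auto simp: DERIV_deriv_iff_real_differentiable)
  have cu: "continuous_on S u" for S
    using u by (intro continuous_at_imp_continuous_on ballI)
      (blast intro: has_vector_derivative_continuous)
  have cv: "continuous_on S v" for S
    using v continuous_on_subset by blast
  have c\<phi>: "continuous_on S \<phi>" for S
    using D by (intro continuous_at_imp_continuous_on ballI) (blast intro: DERIV_isCont)
  have cd\<phi>: "continuous_on S (deriv \<phi>)" for S
    using D2 by (intro continuous_at_imp_continuous_on ballI)
      (blast intro: differentiable_imp_continuous_within)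
  have "bounded (closure {x. \<phi> x \<noteq> 0})"
    using \<phi> compact_imp_bounded unfolding test_function_def by blast
  then obtain B where "\<forall>x\<in>closure {x. \<phi> x \<noteq> 0}. norm x \<le> B"
    unfolding bounded_iff by blast
  then have B: "\<bar>x\<bar> \<le> B" if "\<phi> x \<noteq> 0" for x
    using that closure_subset[of "{x. \<phi> x \<noteq> 0}"] by (auto simp: subset_iff)
  \<comment> \<open>The absolute value makes \<open>K\<close> positive even when
    \<open>\<phi> = 0\<close> leaves \<open>B\<close> arbitrary; the added 1 makes
    \<open>\<phi>\<close> vanish at the endpoints \<open>-K\<close> and \<open>K\<close>
    themselves.\<close>
  define K where "K = \<bar>B\<bar> + 1"
  have K: "K > 0" "B < K"
    by (auto simp: K_def)
  have z: "\<phi> x = 0" if "\<bar>x\<bar> \<ge> K" for x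
    using B[of x] that K by force
  have z': "deriv \<phi> x = 0" if "\<bar>x\<bar> > K" for x
  proof -
    \<comment> \<open>The strict inequality makes the region open, so \<open>\<phi>\<close> is zero
      in a neighbourhood of \<open>x\<close>. The boundary points belong to
      \<open>{-K..K}\<close>.\<close>
    have "open {x::real. \<bar>x\<bar> > K}"
      by (intro open_Collect_less continuous_intros)
    then have "\<forall>\<^sub>F y in nhds x. \<phi> y = 0"
      using that z by (auto simp: eventually_nhds intro!: exI[of _ "{x. \<bar>x\<bar> > K}"])
    then have "deriv \<phi> x = deriv (\<lambda>_. 0) x"
      by (intro deriv_cong_ev refl)
    then show ?thesis by simp
  qed
  have "x \<in> {-K..K}" if "\<phi> x \<noteq> 0 \<or> deriv \<phi> x \<noteq> 0" for x
    using that z[of x] z'[of x] by fastforce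
  \<comment> \<open>Multiplying by the indicator changes neither integrand, so facts about the
    compact interval become facts about the whole line.\<close>
  then have ind: "(\<lambda>x. indicator {-K..K} x *\<^sub>R ?d x) = ?d" "(\<lambda>x. indicator {-K..K} x *\<^sub>R ?e x) = ?e"
    by (force simp: fun_eq_iff indicator_def)+
  have id: "integrable lborel ?d"
    using borel_integrable_compact[of "{-K..K}" ?d] ind
    by (auto intro!: continuous_intros cu cd\<phi>)
  have ie: "integrable lborel ?e"
    using borel_integrable_compact[of "{-K..K}" ?e] ind
    by (auto intro!: continuous_intros cv c\<phi>)
  have "(LINT x|lborel. indicator {-K..K} x *\<^sub>R (?d x + ?e x)) = \<phi> K *\<^sub>R u K - \<phi> (-K) *\<^sub>R u (-K)"
  proof (rule integral_FTC_Icc)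
    show "- K \<le> K" using K by simp
    show "((\<lambda>x. \<phi> x *\<^sub>R u x) has_vector_derivative ?d x + ?e x) (at x within {-K..K})" for x
      using has_vector_derivative_scaleR[OF D[of x] u[of x]]
      by (auto simp: add.commute intro: has_vector_derivative_at_within)
    show "continuous_on {-K..K} (\<lambda>x. ?d x + ?e x)"
      by (intro continuous_intros cu cv c\<phi> cd\<phi>)
  qed
  also have "\<dots> = 0" using z K by simp
  also have "(\<lambda>x. indicator {-K..K} x *\<^sub>R (?d x + ?e x)) = (\<lambda>x. ?d x + ?e x)"
    by (simp only: scaleR_add_right fun_cong[OF ind(1)] fun_cong[OF ind(2)])
  finally have "(LINT x|lborel. ?d x) + (LINT x|lborel. ?e x) = 0"
    using id ie by simp
  then show "(LINT x|lborel. ?d x) = - (LINT x|lborel. ?e x)"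
    by (simp add: eq_neg_iff_add_eq_0)
qed

section \<open>Translation invariance of the norm\<close>

lemma square_integrable_shift:
  assumes "square_integrable f"
  shows "square_integrable (\<lambda>x. f (x - R))"
proof -
  have [measurable]: "f \<in> borel_measurable lborel"
    using assms by (simp add: square_integrable_def)
  then have "(\<lambda>x. f (x - R)) \<in> borel_measurable lborel" by measurable
  moreover have "integrable lborel (\<lambda>x. (norm (f (x - R)))\<^sup>2)"
    using lborel_integrable_real_affine[of "\<lambda>x. (norm (f x))\<^sup>2" 1 "-R"] assms
    by (simp add: square_integrable_def)
  ultimately show ?thesis by (simp add: square_integrable_def)
qed

lemma norm_L2_class_shift:
  assumes "square_integrable f"
  shows "norm (L2_class (\<lambda>x. f (x - R))) = norm (L2_class f)"
proof -
  have n: "norm (L2_class g) = sqrt (LINT x|lborel. g x \<bullet> g x)" if "square_integrable g" for g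
    using that unfolding norm_spinor_L2_def
    by (simp add: inner_spinor_L2.abs_eq)
  show ?thesis
    using lborel_integral_real_affine[of 1 "\<lambda>x. f x \<bullet> f x" "-R"]
    by (simp add: n assms square_integrable_shift)
qed

section \<open>Lower bounds for self-adjoint and quasi-self-adjoint operators\<close>

lemma cinner_commute: "cinner u v = cnj (cinner v u)"
  by transfer (subst Bochner_Integration.integral_cnj[symmetric], simp add: mult.commute)

lemma cinner_cscale_right: "cinner u (cscale c v) = c * cinner u v"
  by transfer (simp add: mult_ac flip: integral_mult_right_zero sum_distrib_left)

lemma cinner_add_right: "cinner u (v + w) = cinner u v + cinner u w"
  by transfer (simp add: distrib_left sum.distrib square_integrable_cinner)

lemma inner_cscale_i: "u \<bullet> cscale \<i> v = - Im (cinner u v)"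
  by (simp flip: Re_cinner add: cinner_cscale_right)

text \<open>Real Cauchy-Schwarz for \<open>u\<close> and \<open>\<i> v\<close>: multiplication by
  \<open>\<i>\<close> preserves the norm and turns the real part of the inner product into minus its
  imaginary part.\<close>

lemma Im_cinner_bound: "\<bar>Im (cinner u v)\<bar> \<le> norm u * norm v"
proof -
  have "norm (cscale \<i> v) = norm v"
    unfolding norm_eq_sqrt_inner Re_cinner[symmetric] cinner_cscale_right
    by (subst cinner_commute) (simp add: cinner_cscale_right)
  then show ?thesis
    using Cauchy_Schwarz_ineq2[of u "cscale \<i> v"] by (simp add: inner_cscale_i)
qed

text \<open>Here \<open>g\<close> stands for \<open>(A - z) u\<close>. Symmetry makes the inner
  product of \<open>u\<close> with \<open>A u\<close> real, so its imaginary part gives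
  \<open>Im z |u|^2 = - Im (cinner u g)\<close>, and Cauchy-Schwarz applies.\<close>

lemma self_adjoint_lower_bound:
  assumes "self_adjoint A" and "(u, cscale z u + g) \<in> A"
  shows "\<bar>Im z\<bar> * norm u \<le> norm g"
proof (cases "u = 0")
  case False
  have "(u, cscale z u + g) \<in> adjoint_op A"
    using assms by (simp add: self_adjoint_def)
  then have "cinner u (cscale z u + g) = cinner (cscale z u + g) u"
    using assms(2) unfolding adjoint_op_def by blast
  then have "Im (cinner u (cscale z u + g)) = 0"
    using arg_cong[OF cinner_commute[of "cscale z u + g" u], of Im] by simp
  moreover have "Im (cinner u u) = 0"
    using arg_cong[OF cinner_commute[of u u], of Im] by simp
  moreover have "Re (cinner u u) = norm u * norm u"
    by (simp add: Re_cinner power2_norm_eq_inner flip: power2_eq_square)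
  ultimately have "Im z * (norm u * norm u) = - Im (cinner u g)"
    by (simp add: cinner_add_right cinner_cscale_right)
  from arg_cong[OF this, of abs] have "\<bar>Im z\<bar> * (norm u * norm u) \<le> norm u * norm g"
    using Im_cinner_bound[of u g] by (simp add: abs_mult)
  then show ?thesis using False by (simp add: mult.left_commute)
qed simp

text \<open>Complex linearity of \<open>W\<close> carries the relation between \<open>u\<close>,
  \<open>z\<close> and \<open>g\<close> over to \<open>W u\<close>, \<open>z\<close> and
  \<open>W g\<close>. Returning to \<open>u\<close> and \<open>g\<close> costs only the bounds of
  \<open>W\<close> and \<open>inv W\<close>, so \<open>C\<close> is uniform in
  \<open>z\<close>.\<close>

lemma quasi_self_adjoint_lower_bound:
  assumes "quasi_self_adjoint T"
  obtains C where "\<And>u z g. (u, cscale z u + g) \<in> T \<Longrightarrow> \<bar>Im z\<bar> * norm u \<le> C * norm g"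
proof -
  obtain W where W: "bounded_clinear W" "bij W" "bounded_clinear (inv W)"
    and sa: "self_adjoint (conjugate_op W T)"
    using assms unfolding quasi_self_adjoint_def by blast
  interpret W: bounded_linear W using W(1) by (simp add: bounded_clinear_def)
  interpret V: bounded_linear "inv W" using W(3) by (simp add: bounded_clinear_def)
  obtain a where a: "a > 0" "\<And>x. norm (W x) \<le> norm x * a" using W.pos_bounded by blast
  obtain b where b: "b > 0" "\<And>x. norm (inv W x) \<le> norm x * b" using V.pos_bounded by blast
  have "\<bar>Im z\<bar> * norm u \<le> (b * a) * norm g" if "(u, cscale z u + g) \<in> T" for u z g
  proof -
    have "W (cscale z u + g) = cscale z (W u) + W g"
      using W(1) by (simp add: W.add bounded_clinear_def)
    then have "(W u, cscale z (W u) + W g) \<in> conjugate_op W T"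
      using that unfolding conjugate_op_def by (smt (verit) mem_Collect_eq)
    then have lb: "\<bar>Im z\<bar> * norm (W u) \<le> norm (W g)"
      by (rule self_adjoint_lower_bound[OF sa])
    have "norm u \<le> norm (W u) * b"
      using b(2)[of "W u"] W(2) by (simp add: bij_is_inj)
    then have "\<bar>Im z\<bar> * norm u \<le> \<bar>Im z\<bar> * (norm (W u) * b)"
      by (intro mult_left_mono) auto
    also have "\<dots> \<le> norm (W g) * b"
      using mult_right_mono[OF lb, of b] b(1) by (simp add: mult.assoc)
    also have "\<dots> \<le> norm g * a * b"
      using a(2)[of g] b(1) by (intro mult_right_mono) auto
    finally show ?thesis by (simp add: mult_ac)
  qed
  then show thesis using that by blast
qed

section \<open>Gaussian trial spinors\<close>

text \<open>The factor 1/4 makes the square a multiple of the standard normal density, so the needed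
  integrals are normal moments.\<close>

definition gauss :: "real \<Rightarrow> real" where
  "gauss x = exp (- x\<^sup>2 / 4)"

lemma gauss_square: "(gauss x)\<^sup>2 = sqrt (2 * pi) * std_normal_density x"
  by (simp add: gauss_def std_normal_density_def flip: exp_double)

lemma square_integrable_gauss:
  "square_integrable gauss" "square_integrable (\<lambda>x. x * gauss x)"
proof -
  have [measurable]: "gauss \<in> borel_measurable borel"
    unfolding gauss_def[abs_def] by measurable
  show "square_integrable gauss"
    using integrable_std_normal_moment[of 0] by (simp add: square_integrable_def gauss_square)
  show "square_integrable (\<lambda>x. x * gauss x)"
    using integrable_mult_right[OF integrable_std_normal_moment[of 2], of "sqrt (2 * pi)"]
    by (simp add: square_integrable_def gauss_square power_mult_distrib mult_ac abs_mult)
qed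

lemma gauss_has_derivative: "(gauss has_real_derivative - x * gauss x / 2) (at x)"
  unfolding gauss_def[abs_def] by (auto intro!: derivative_eq_intros)

lemma vector_4_nth:
  "(vector [w, x, y, z] :: 'a::zero^4) $ 1 = w"
  "(vector [w, x, y, z] :: 'a::zero^4) $ 2 = x"
  "(vector [w, x, y, z] :: 'a::zero^4) $ 3 = y"
  "(vector [w, x, y, z] :: 'a::zero^4) $ 4 = z"
  by (simp_all add: vector_def)

text \<open>The vector \<open>(1, -\<i>)\<close> is an eigenvector of \<open>pauli2\<close> for the
  eigenvalue -1; repeating it in both halves gives one of the off-diagonal block matrix.\<close>

lemma alpha2_eigenvector:
  "alpha2 *v vector [1, - \<i>, 1, - \<i>] = - vector [1, - \<i>, 1, - \<i>]"
  by (simp add: alpha2_def dirac_block_def pauli2_def vec_eq_iff forall_4 matrix_vector_mult_def sum_4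
      vector_4_nth)

text \<open>These are the conditions that \<open>H_op\<close> imposes on each component of the trial
  spinor centred at \<open>R\<close>, with \<open>c\<close> an entry of the eigenvector.\<close>

lemma gauss_component_in_domain_D:
  fixes c :: complex and R :: real
  defines "u \<equiv> \<lambda>x. of_real (gauss (x - R)) * c"
    and "v \<equiv> \<lambda>x. of_real (- (x - R) * gauss (x - R) / 2) * c"
  shows "u \<in> domain_D" "square_integrable v" "weak_derivative u v"
proof -
  have lin: "linear (\<lambda>t::real. of_real t * c)"
    by (rule linearI) (auto simp: algebra_simps scaleR_conv_of_real)
  note sh = square_integrable_gauss[THEN square_integrable_shift, of R]
  show v: "square_integrable v"
    using square_integrable_linear[OF lin square_integrable_scaleR[OF sh(2), of "-1/2"]]
    unfolding v_def
    by (rule back_subst[of square_integrable]) (simp add: fun_eq_iff field_simps)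
  have u: "square_integrable u"
    using square_integrable_linear[OF lin sh(1)] by (simp add: u_def)
  \<comment> \<open>The weight is split as \<open>x = (x - R) + R\<close>, which leaves translates
    of \<open>x * gauss x\<close> and \<open>gauss x\<close>.\<close>
  have "square_integrable (\<lambda>x. of_real ((x - R) * gauss (x - R) + R * gauss (x - R)) * c)"
    using square_integrable_linear[OF lin
        square_integrable_add[OF sh(2) square_integrable_scaleR[OF sh(1), of R]]]
    by simp
  then have "square_integrable (\<lambda>x. of_real x * u x)"
    by (simp add: u_def algebra_simps)
  then have "u \<in> weighted_L2"
    using u
    by (simp add: weighted_L2_def square_integrable_def norm_mult power_mult_distrib mult.commute)
  moreover show "weak_derivative u v"
  proof (rule weak_derivative_C1)
    have "((\<lambda>x. gauss (x - R)) has_real_derivative - (x - R) * gauss (x - R) / 2) (at x)" for x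
      using DERIV_chain'[OF DERIV_diff[OF DERIV_ident DERIV_const] gauss_has_derivative] by simp
    then show "(u has_vector_derivative v x) (at x)" for x
      unfolding u_def v_def
      by (intro has_vector_derivative_mult_left has_vector_derivative_of_real)
        (simp add: has_real_derivative_iff_has_vector_derivative)
    show "continuous_on UNIV v"
      unfolding v_def gauss_def by (intro continuous_intros) auto
  qed
  ultimately show "u \<in> domain_D"
    using u v by (auto simp: domain_D_def sobolev_H1_def)
qed

section \<open>Contradiction from distant Gaussians\<close>

lemma L2_class_add:
  "square_integrable f \<Longrightarrow> square_integrable g \<Longrightarrow>
    L2_class (\<lambda>x. f x + g x) = L2_class f + L2_class g"
  by (simp add: plus_spinor_L2.abs_eq)

lemma L2_class_smult:
  "square_integrable f \<Longrightarrow> L2_class (\<lambda>x. c *s f x) = cscale c (L2_class f)"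
  by (simp add: cscale.abs_eq)

theorem mainTheorem7:
  fixes m \<theta> :: real
  assumes "m \<ge> 0" and "- (pi / 2) < \<theta>" and "\<theta> < pi / 2" and "\<theta> \<noteq> 0"
  shows "\<not> quasi_self_adjoint (H_op m \<theta>)"
proof
  assume "quasi_self_adjoint (H_op m \<theta>)"
  then obtain C where
    C: "\<And>u z g. (u, cscale z u + g) \<in> H_op m \<theta> \<Longrightarrow> \<bar>Im z\<bar> * norm u \<le> C * norm g"
    using quasi_self_adjoint_lower_bound by blast
  define \<eta> :: "complex^4" where "\<eta> = vector [1, - \<i>, 1, - \<i>]"
  define a where "a = exp (- \<i> * complex_of_real \<theta> / 2)"
  define b where "b = exp (\<i> * complex_of_real \<theta> / 2)"
  define u where "u x = complex_of_real (gauss x) *s \<eta>" for x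
  define v where "v x = complex_of_real (- x * gauss x / 2) *s \<eta>" for x
  \<comment> \<open>This is \<open>(H - z)\<close> on the trial spinor, recentred at 0: the
    derivative gives the \<open>alpha1\<close> term, the remainder \<open>x - R\<close> of the
    potential gives \<open>b *s \<eta>\<close>, and the last summand is the mass term.\<close>
  define g where "g x = complex_of_real (x * gauss x) *s ((\<i> * a / 2) *s (alpha1 *v \<eta>) + b *s \<eta>)
    + complex_of_real (gauss x) *s (complex_of_real m *s (alpha3 *v \<eta>))" for x
  have lin: "linear (\<lambda>t::real. complex_of_real t *s w)" for w :: "complex^4"
    by (rule linearI)
      (simp_all add: vec_eq_iff algebra_simps vector_scaleR_component, simp add: scaleR_conv_of_real)
  have u: "square_integrable u"
    unfolding u_def[abs_def] by (rule square_integrable_linear[OF lin square_integrable_gauss(1)])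
  have g: "square_integrable g"
    unfolding g_def[abs_def]
    by (intro square_integrable_add square_integrable_linear[OF lin] square_integrable_gauss)
  have bound: "R * \<bar>sin (\<theta> / 2)\<bar> * norm (L2_class u) \<le> C * norm (L2_class g)" if "R > 0" for R
  proof -
    let ?u = "\<lambda>x. u (x - R)" and ?v = "\<lambda>x. v (x - R)" and ?g = "\<lambda>x. g (x - R)"
    let ?z = "complex_of_real R * b"
    \<comment> \<open>Since \<open>\<eta>\<close> has eigenvalue -1, the potential term is
      \<open>b x\<close> times the spinor; its part \<open>b R\<close> is exactly
      \<open>?z\<close>.\<close>
    have "H_expr m \<theta> ?u ?v x = ?z *s ?u x + ?g x" for x
      unfolding H_expr_def u_def v_def g_def vector_scalar_commute a_def[symmetric] b_def[symmetric]
      using alpha2_eigenvector[folded \<eta>_def]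
      by (simp add: vec_eq_iff algebra_simps) (simp add: field_simps)
    then have "L2_class (H_expr m \<theta> ?u ?v) = cscale ?z (L2_class ?u) + L2_class ?g"
      using u g
      by (simp add: L2_class_add[symmetric] L2_class_smult[symmetric]
          square_integrable_shift square_integrable_smult) presburger
    moreover have "(L2_class ?u, L2_class (H_expr m \<theta> ?u ?v)) \<in> H_op m \<theta>"
      unfolding H_op_def
      using gauss_component_in_domain_D[of R]
      by (force simp: u_def v_def)
    ultimately have "\<bar>Im ?z\<bar> * norm (L2_class ?u) \<le> C * norm (L2_class ?g)"
      using C by metis
    moreover have "Im ?z = R * sin (\<theta> / 2)"
      by (simp add: b_def Im_exp)
    ultimately show ?thesis
      using that u g by (simp add: norm_L2_class_shift abs_mult)
  qed
  have "norm (L2_class u) \<noteq> 0"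
  proof
    assume "norm (L2_class u) = 0"
    then have "L2_class u \<bullet> L2_class u = 0" by simp
    \<comment> \<open>The vector \<open>\<eta>\<close> has squared length 4, so the integral is
      \<open>4 * sqrt (2 * pi)\<close> times the total mass 1 of the normal density.\<close>
    moreover have "u x \<bullet> u x = 4 * sqrt (2 * pi) * std_normal_density x" for x
      by (simp add: u_def \<eta>_def inner_vec_def sum_4 vector_4_nth inner_complex_def gauss_square
          flip: power2_eq_square)
    ultimately show False
      using integral_std_normal_moment_even[of 0] u
      by (simp add: inner_spinor_L2.abs_eq)
  qed
  moreover have "sin (\<theta> / 2) \<noteq> 0"
    using assms(2-4) pi_gt_zero sin_eq_0_pi[of "\<theta> / 2"] by linarith
  ultimately have pos: "\<bar>sin (\<theta> / 2)\<bar> * norm (L2_class u) > 0" (is "?s > 0")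
    by simp
  \<comment> \<open>Chosen so that the left side of \<open>bound\<close> exceeds the right by at
    least 1; the absolute value covers a negative \<open>C\<close> and keeps \<open>R\<close>
    positive.\<close>
  define R where "R = (\<bar>C * norm (L2_class g)\<bar> + 1) / ?s"
  have "R > 0" using pos by (simp add: R_def)
  from bound[OF this] have "R * ?s \<le> C * norm (L2_class g)" by (simp only: mult.assoc)
  moreover have "R * ?s = \<bar>C * norm (L2_class g)\<bar> + 1"
    using nonzero_eq_divide_eq[THEN iffD1, OF _ R_def] pos by linarith
  ultimately show False by linarith
qed

end
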